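(* Let $S$ and $A$ be finite nonempty sets and let $T$ be a set of policies (transducers from $S$ to $A$) that is closed under trajectory splicing. Let $\varepsilon$ be a teleo-environment and let $\pi\in T$ be optimal for $\varepsilon$ within $T$. Let $h=((s_1,a_1),\dots,(s_n,a_n))$ be a finite sequence in $S\times A$ that is possible for $\pi$ and such that $h_\bot=((a_1,(s_1,\bot)),\dots,(a_n,(s_n,\bot)))$ is possible for $\varepsilon$. Then $\pi\bullet h$ is optimal for $\varepsilon\bullet h_\bot$ within the class $\{\tau\bullet h : \tau\in T,\ h \text{ possible for } \tau\}$.
   Context: Transducers. Let $I,O$ be finite sets. A transducer $\tau$ from $I$ to $O$ is (coinductively) a probability distribution $p_\tau$ on $O$ together with, for each $i\in I$ and each $o\in O$ with $p_\tau(o)>0$, another transducer $\tau\bullet(i,o)$ from $I$ to $O$, called "$\tau$ evolved by $(i,o)$". (The output distribution does not depend on the simultaneously received input.) For a finite sequence $h=((i_1,o_1),\dots,(i_n,o_n))$, $n\ge 0$, say that $h$ is possible for $\tau$ if each $o_k$ has positive probability under the output distribution of $\tau\bullet(i_1,o_1)\bullet\cdots\bullet(i_{k-1},o_{k-1})$; then $\tau\bullet h$ denotes the iterated evolution. Two transducers are equal iff they have the same output distributions after every possible sequence $h$ (including the empty one). Policies and teleo-environments. $S$ is the set of sensor values and $A$ the set of actions. A policy is a transducer from $S$ to $A$. A teleo-environment is a transducer from $A$ to $S\times\{\bot,\top\}$, where $\top$ is the success signal and $\bot$ the lack-of-success signal; the success signal is not observed by the policy. Coupling. Given a policy $\pi$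 and a teleo-environment $\varepsilon$, put $\pi_1=\pi$, $\varepsilon_1=\varepsilon$. At each time step $t=1,2,\dots$ an action $a_t\sim p_{\pi_t}$ and a pair $(s_t,r_t)\sim p_{\varepsilon_t}$ are drawn independently of each other (given the past), and then $\pi_{t+1}=\pi_t\bullet(s_t,a_t)$ and $\varepsilon_{t+1}=\varepsilon_t\bullet(a_t,(s_t,r_t))$. Let $V(\pi,\varepsilon)$ be the probability that $r_t=\top$ for at least one $t\ge 1$. Constrained optimality. For a set $T$ of policies, $\pi$ is optimal for $\varepsilon$ within $T$ if $\pi\in T$ and $V(\pi,\varepsilon)\ge V(\pi',\varepsilon)$ for every $\pi'\in T$. Trajectory splicing. For transducers $\pi,\pi'$ from $I$ to $O$ and a finite sequence $h$ of input-output pairs possible for both, "$\pi$ spliced with $\pi'$ along $h$" is the transducer that behaves exactly like $\pi$, except that if it produces the outputs in $h$ in response to the inputs in $h$, it from then on behaves exactly as $\pi'$ would in the same situation, i.e. its evolution by $h$ is $\pi'\bullet h$. A set $T$ of transducers is closed under trajectory splicing if, for all $\pi,\pi'\in T$ and every finite sequence $h$ possible for both $\pi$ and $\pi'$, the transducer $\pi$ spliced with $\pi'$ along $h$ is in $T$. *)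

theory Defs
  imports "HOL-Probability.Probability"
begin

section \<open>Transducers\<close>

text \<open>
  A transducer has successors only for outputs of positive probability. A codatatype cannot
  express this dependency, so it leaves the successor function partial with arbitrary domain;
  the type of transducers is then the subset of those raw trees in which, hereditarily, the
  domain of the successor function is the right one. Since no information is stored for outputs
  of probability zero, equality of transducers is equality of behaviour (\<open>transducer_eq_iff\<close>).
\<close>

codatatype ('i, 'o) raw_transducer =
  Raw (raw_out: "'o pmf") (raw_succ: "'i \<times> 'o \<Rightarrow> ('i, 'o) raw_transducer option")

coinductive wf_raw :: "('i, 'o) raw_transducer \<Rightarrow> bool" where
  wf_rawI: "\<lbrakk>\<And>x y. raw_succ \<tau> (x, y) \<noteq> None \<longleftrightarrow> pmf (raw_out \<tau>) y > 0;
     \<And>x y \<tau>'. raw_succ \<tau> (x, y) = Some \<tau>' \<Longrightarrow> wf_raw \<tau>'\<rbrakk> \<Longrightarrow> wf_raw \<tau>"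

primcorec raw_const :: "'o pmf \<Rightarrow> ('i, 'o) raw_transducer" where
  "raw_out (raw_const p) = p"
| "raw_succ (raw_const p) =
     (\<lambda>xy. map_option (\<lambda>_. raw_const p) (if pmf p (snd xy) > 0 then Some () else None))"

lemma wf_raw_const: "wf_raw (raw_const p :: ('i, 'o) raw_transducer)"
proof -
  have "wf_raw \<tau>" if "\<tau> = raw_const p" for \<tau> :: "('i, 'o) raw_transducer"
    using that
  proof (coinduction arbitrary: \<tau> rule: wf_raw.coinduct)
    case (wf_raw \<tau>)
    have "\<tau>' = raw_const p" if "raw_succ \<tau> (x, y) = Some \<tau>'" for x y \<tau>'
      using that unfolding wf_raw by (simp split: if_split_asm)
    moreover have "raw_succ \<tau> (x, y) \<noteq> None \<longleftrightarrow> pmf (raw_out \<tau>) y > 0" for x y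
      unfolding wf_raw by simp
    ultimately show ?case
      by blast
  qed
  then show ?thesis
    by blast
qed

lemma wf_raw_succ: "wf_raw \<tau> \<Longrightarrow> raw_succ \<tau> xy = Some \<tau>' \<Longrightarrow> wf_raw \<tau>'"
  by (cases xy) (metis wf_raw.cases)

typedef ('i, 'o) transducer = "{\<tau> :: ('i, 'o) raw_transducer. wf_raw \<tau>}"
  using wf_raw_const by blast

setup_lifting type_definition_transducer

lift_definition out :: "('i, 'o) transducer \<Rightarrow> 'o pmf" is raw_out .

text \<open>
  Evolution is totalised: evolving by an output of probability zero has no effect.
\<close>

lift_definition evolve :: "('i, 'o) transducer \<Rightarrow> 'i \<times> 'o \<Rightarrow> ('i, 'o) transducer"
    (infixl \<open>\<bullet>\<^sub>1\<close> 70)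
  is "\<lambda>\<tau> xy. case raw_succ \<tau> xy of None \<Rightarrow> \<tau> | Some \<tau>' \<Rightarrow> \<tau>'"
  by (simp split: option.split) (blast intro: wf_raw_succ)

lift_definition mk_transducer ::
    "'o pmf \<Rightarrow> ('i \<times> 'o \<Rightarrow> ('i, 'o) transducer) \<Rightarrow> ('i, 'o) transducer"
  is "\<lambda>p f. Raw p (\<lambda>xy. if pmf p (snd xy) > 0 then Some (f xy) else None)"
  by (rule wf_rawI) (auto split: if_split_asm)

lemma out_mk_transducer [simp]: "out (mk_transducer p f) = p"
  by transfer simp

lemma evolve_mk_transducer [simp]:
  "pmf p (snd xy) > 0 \<Longrightarrow> mk_transducer p f \<bullet>\<^sub>1 xy = f xy"
  by transfer simp

primrec possible :: "('i, 'o) transducer \<Rightarrow> ('i \<times> 'o) list \<Rightarrow> bool" where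
  "possible \<tau> [] \<longleftrightarrow> True"
| "possible \<tau> (xy # h) \<longleftrightarrow> pmf (out \<tau>) (snd xy) > 0 \<and> possible (\<tau> \<bullet>\<^sub>1 xy) h"

definition evolve_along :: "('i, 'o) transducer \<Rightarrow> ('i \<times> 'o) list \<Rightarrow> ('i, 'o) transducer"
    (infixl \<open>\<bullet>\<^sub>*\<close> 70) where
  "\<tau> \<bullet>\<^sub>* h = foldl (\<bullet>\<^sub>1) \<tau> h"

lemma evolve_along_Nil [simp]: "\<tau> \<bullet>\<^sub>* [] = \<tau>"
  and evolve_along_Cons [simp]: "\<tau> \<bullet>\<^sub>* (xy # h) = (\<tau> \<bullet>\<^sub>1 xy) \<bullet>\<^sub>* h"
  by (simp_all add: evolve_along_def)

lemma raw_succ_eq_None_iff: "wf_raw \<rho> \<Longrightarrow> raw_succ \<rho> xy = None \<longleftrightarrow> \<not> pmf (raw_out \<rho>) (snd xy) > 0"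
  by (cases xy) (metis snd_conv wf_raw.cases)

lemma transducer_coinduct:
  fixes \<tau> \<tau>' :: "('i, 'o) transducer"
  assumes R: "R \<tau> \<tau>'"
    and out: "\<And>\<sigma> \<sigma>'. R \<sigma> \<sigma>' \<Longrightarrow> out \<sigma> = out \<sigma>'"
    and step: "\<And>\<sigma> \<sigma>' xy. R \<sigma> \<sigma>' \<Longrightarrow> pmf (out \<sigma>) (snd xy) > 0 \<Longrightarrow> R (\<sigma> \<bullet>\<^sub>1 xy) (\<sigma>' \<bullet>\<^sub>1 xy)"
  shows "\<tau> = \<tau>'"
proof -
  define Q where "Q \<rho> \<rho>' \<longleftrightarrow> (\<exists>\<sigma> \<sigma>'. R \<sigma> \<sigma>' \<and> \<rho> = Rep_transducer \<sigma> \<and> \<rho>' = Rep_transducer \<sigma>')"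
    for \<rho> \<rho>' :: "('i, 'o) raw_transducer"
  have Q_step: "raw_out \<rho> = raw_out \<rho>' \<and> rel_fun (=) (rel_option Q) (raw_succ \<rho>) (raw_succ \<rho>')"
    if "Q \<rho> \<rho>'" for \<rho> \<rho>'
  proof -
    from that obtain \<sigma> \<sigma>' where \<sigma>: "R \<sigma> \<sigma>'" and
      \<rho>: "\<rho> = Rep_transducer \<sigma>" "\<rho>' = Rep_transducer \<sigma>'"
      unfolding Q_def by blast
    have eq: "raw_out \<rho> = raw_out \<rho>'"
      using out[OF \<sigma>] \<rho> by (simp add: out.rep_eq)
    have wf: "wf_raw \<rho>" "wf_raw \<rho>'"
      using Rep_transducer \<rho> by auto
    have "rel_option Q (raw_succ \<rho> xy) (raw_succ \<rho>' xy)" for xy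
    proof (cases "pmf (raw_out \<rho>) (snd xy) > 0")
      case True
      then obtain \<upsilon> \<upsilon>' where s: "raw_succ \<rho> xy = Some \<upsilon>" "raw_succ \<rho>' xy = Some \<upsilon>'"
        using wf eq raw_succ_eq_None_iff by (metis option.exhaust)
      have "R (\<sigma> \<bullet>\<^sub>1 xy) (\<sigma>' \<bullet>\<^sub>1 xy)"
        using step[OF \<sigma>, of xy] True \<rho> by (simp add: out.rep_eq)
      moreover have "\<upsilon> = Rep_transducer (\<sigma> \<bullet>\<^sub>1 xy)" "\<upsilon>' = Rep_transducer (\<sigma>' \<bullet>\<^sub>1 xy)"
        using s \<rho> by (simp_all add: evolve.rep_eq)
      ultimately have "Q \<upsilon> \<upsilon>'" unfolding Q_def by blast
      then show ?thesis using s by simp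
    next
      case False
      then have "raw_succ \<rho> xy = None" "raw_succ \<rho>' xy = None"
        using wf eq raw_succ_eq_None_iff by metis+
      then show ?thesis by simp
    qed
    with eq show ?thesis by (simp add: rel_fun_def)
  qed
  have "Q (Rep_transducer \<tau>) (Rep_transducer \<tau>')"
    using R unfolding Q_def by blast
  then have "Rep_transducer \<tau> = Rep_transducer \<tau>'"
    by (rule raw_transducer.coinduct[of Q]) (rule Q_step)
  then show ?thesis by (simp add: Rep_transducer_inject)
qed

lemma transducer_eq_iff:
  "\<tau> = \<tau>' \<longleftrightarrow> (\<forall>h. possible \<tau> h \<longrightarrow> out (\<tau> \<bullet>\<^sub>* h) = out (\<tau>' \<bullet>\<^sub>* h))"
proof
  assume "\<forall>h. possible \<tau> h \<longrightarrow> out (\<tau> \<bullet>\<^sub>* h) = out (\<tau>' \<bullet>\<^sub>* h)"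
  then show "\<tau> = \<tau>'"
  proof (rule transducer_coinduct
      [where R = "\<lambda>\<sigma> \<sigma>'. \<forall>h. possible \<sigma> h \<longrightarrow> out (\<sigma> \<bullet>\<^sub>* h) = out (\<sigma>' \<bullet>\<^sub>* h)"])
    fix \<sigma> \<sigma>' :: "('a, 'b) transducer"
    assume H: "\<forall>h. possible \<sigma> h \<longrightarrow> out (\<sigma> \<bullet>\<^sub>* h) = out (\<sigma>' \<bullet>\<^sub>* h)"
    show "out \<sigma> = out \<sigma>'"
      using H[rule_format, of "[]"] by simp
    show "\<forall>h. possible (\<sigma> \<bullet>\<^sub>1 xy) h \<longrightarrow> out (\<sigma> \<bullet>\<^sub>1 xy \<bullet>\<^sub>* h) = out (\<sigma>' \<bullet>\<^sub>1 xy \<bullet>\<^sub>* h)"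
      if "pmf (out \<sigma>) (snd xy) > 0" for xy
      using H[rule_format, of "xy # h" for h] that by simp
  qed
qed simp


section \<open>Trajectory splicing\<close>

text \<open>Meaningful only if \<open>h\<close> is possible for both transducers.\<close>

fun splice_along ::
    "('i, 'o) transducer \<Rightarrow> ('i, 'o) transducer \<Rightarrow> ('i \<times> 'o) list \<Rightarrow> ('i, 'o) transducer" where
  "splice_along \<tau> \<tau>' [] = \<tau>'"
| "splice_along \<tau> \<tau>' (xy # h) = mk_transducer (out \<tau>)
     (\<lambda>zw. if zw = xy then splice_along (\<tau> \<bullet>\<^sub>1 xy) (\<tau>' \<bullet>\<^sub>1 xy) h else \<tau> \<bullet>\<^sub>1 zw)"

definition closed_under_splicing :: "('i, 'o) transducer set \<Rightarrow> bool" where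
  "closed_under_splicing T \<longleftrightarrow>
     (\<forall>\<tau>\<in>T. \<forall>\<tau>'\<in>T. \<forall>h. possible \<tau> h \<and> possible \<tau>' h \<longrightarrow> splice_along \<tau> \<tau>' h \<in> T)"

lemma splice_along_evolve: "possible \<tau> h \<Longrightarrow> splice_along \<tau> \<tau>' h \<bullet>\<^sub>* h = \<tau>' \<bullet>\<^sub>* h"
  by (induction \<tau> \<tau>' h rule: splice_along.induct) simp_all

lemma out_splice_along:
  assumes "possible \<tau> k" "\<not> (\<exists>k'. k = h @ k')"
  shows "possible (splice_along \<tau> \<tau>' h) k \<and> out (splice_along \<tau> \<tau>' h \<bullet>\<^sub>* k) = out (\<tau> \<bullet>\<^sub>* k)"
  using assms
proof (induction h arbitrary: \<tau> \<tau>' k)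
  case (Cons xy h)
  then show ?case by (cases k) auto
qed simp


section \<open>Policies and teleo-environments\<close>

text \<open>The success signal \<open>\<top>\<close> is \<open>True\<close> and the lack-of-success signal \<open>\<bottom>\<close> is \<open>False\<close>.\<close>

type_synonym ('s, 'a) policy = "('s, 'a) transducer"
type_synonym ('s, 'a) teleo_environment = "('a, 's \<times> bool) transducer"

text \<open>
  One time step of the coupling is recorded as \<open>(a, (s, r))\<close>, i.e. as an input-output pair of the
  teleo-environment; the policy sees it as \<open>(s, a)\<close>.
\<close>

type_synonym ('s, 'a) step = "'a \<times> ('s \<times> bool)"

definition policy_view :: "('s, 'a) step \<Rightarrow> 's \<times> 'a" where
  "policy_view = (\<lambda>(a, (s, r)). (s, a))"

definition unsuccessful :: "'s \<times> 'a \<Rightarrow> ('s, 'a) step" where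
  "unsuccessful = (\<lambda>(s, a). (a, (s, False)))"

definition step_pmf :: "('s, 'a) policy \<Rightarrow> ('s, 'a) teleo_environment \<Rightarrow> ('s, 'a) step list \<Rightarrow>
    ('s, 'a) step pmf" where
  "step_pmf \<pi> \<epsilon> past = pair_pmf (out (\<pi> \<bullet>\<^sub>* map policy_view past)) (out (\<epsilon> \<bullet>\<^sub>* past))"

text \<open>
  The law of the infinite run (with time starting at \<open>0\<close>) is the measure given by the
  Ionescu-Tulcea theorem for the transition kernels \<open>step_pmf\<close>; it is determined by the
  probabilities of its cylinders (\<open>emeasure_coupling_cylinder\<close>).
\<close>

definition coupling_kernel :: "('s, 'a) policy \<Rightarrow> ('s, 'a) teleo_environment \<Rightarrow> nat \<Rightarrow>
    (nat \<Rightarrow> ('s, 'a) step) \<Rightarrow> ('s, 'a) step measure" where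
  "coupling_kernel \<pi> \<epsilon> t \<omega> = measure_pmf (step_pmf \<pi> \<epsilon> (map \<omega> [0..<t]))"

definition coupling :: "('s::finite, 'a::finite) policy \<Rightarrow> ('s, 'a) teleo_environment \<Rightarrow>
    (nat \<Rightarrow> ('s, 'a) step) measure" where
  "coupling \<pi> \<epsilon> = projective_family.lim UNIV
     (Ionescu_Tulcea.CI (coupling_kernel \<pi> \<epsilon>) (\<lambda>_. count_space UNIV)) (\<lambda>_. count_space UNIV)"

lemma Ionescu_Tulcea_coupling:
  fixes \<pi> :: "('s::finite, 'a::finite) policy"
  shows "Ionescu_Tulcea (coupling_kernel \<pi> \<epsilon>) (\<lambda>_. count_space UNIV)"
proof (rule Ionescu_Tulcea.intro)
  fix i
  show "coupling_kernel \<pi> \<epsilon> i \<in>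
      measurable (PiM {0..<i} (\<lambda>_. count_space UNIV)) (subprob_algebra (count_space UNIV))"
    by (subst count_space_PiM_finite)
      (auto simp: coupling_kernel_def space_subprob_algebra measure_pmf.subprob_space_axioms)
qed (simp add: coupling_kernel_def measure_pmf.prob_space_axioms)

lemma space_coupling [simp]: "space (coupling \<pi> \<epsilon>) = UNIV"
  and sets_coupling [measurable_cong]:
    "sets (coupling \<pi> \<epsilon>) = sets (PiM UNIV (\<lambda>_. count_space UNIV))"
proof -
  interpret Ionescu_Tulcea "coupling_kernel \<pi> \<epsilon>" "\<lambda>_. count_space UNIV"
    by (rule Ionescu_Tulcea_coupling)
  show "space (coupling \<pi> \<epsilon>) = UNIV"
    unfolding coupling_def PF.space_lim by (simp add: space_PiM)
  show "sets (coupling \<pi> \<epsilon>) = sets (PiM UNIV (\<lambda>_. count_space UNIV))"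
    unfolding coupling_def PF.sets_lim ..
qed

lemma emeasure_coupling_cylinder:
  fixes \<pi> :: "('s::finite, 'a::finite) policy"
  shows "emeasure (coupling \<pi> \<epsilon>) {\<omega>. \<forall>t<n. \<omega> t = \<xi> t} =
     (\<Prod>t<n. ennreal (pmf (step_pmf \<pi> \<epsilon> (map \<xi> [0..<t])) (\<xi> t)))"
proof -
  let ?M = "\<lambda>_::nat. count_space (UNIV :: ('s, 'a) step set)"
  interpret Ionescu_Tulcea "coupling_kernel \<pi> \<epsilon>" ?M
    by (rule Ionescu_Tulcea_coupling)
  have sing: "{restrict \<xi> {0..<m}} \<in> sets (PiM {0..<m} ?M)" for m
    by (subst count_space_PiM_finite) auto
  have C: "emeasure (C 0 n (\<lambda>_. undefined)) {restrict \<xi> {0..<n}} =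
    (\<Prod>t<n. ennreal (pmf (step_pmf \<pi> \<epsilon> (map \<xi> [0..<t])) (\<xi> t)))" for n
  proof (induction n)
    case 0
    have "restrict \<xi> {0..<0} = (\<lambda>_. undefined)" by auto
    with sing[of 0] show ?case by simp
  next
    case (Suc n)
    let ?u = "\<lambda>_::nat. undefined :: ('s, 'a) step"
    have u: "?u \<in> space (PiM {0..<0} ?M)" by (simp add: space_PiM)
    have eP: "emeasure (eP n \<omega>) {restrict \<xi> {0..<Suc n}} =
      ennreal (pmf (step_pmf \<pi> \<epsilon> (map \<xi> [0..<n])) (\<xi> n)) * indicator {restrict \<xi> {0..<n}} \<omega>"
      if \<omega>: "\<omega> \<in> space (PiM {0..<n} ?M)" for \<omega>
    proof (cases "\<omega> = restrict \<xi> {0..<n}")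
      case True
      have "fun_upd \<omega> n -` {restrict \<xi> {0..<Suc n}} = {\<xi> n}"
        unfolding True by (auto simp: fun_eq_iff restrict_def less_Suc_eq split: if_splits)
      moreover have "map (restrict \<xi> {0..<n}) [0..<n] = map \<xi> [0..<n]"
        by (intro map_cong) auto
      ultimately show ?thesis
        using True unfolding emeasure_eP[OF \<omega> sing]
        by (simp add: coupling_kernel_def emeasure_pmf_single del: map_eq_conv)
    next
      case False
      have "fun_upd \<omega> n -` {restrict \<xi> {0..<Suc n}} = {}"
      proof -
        have "\<omega> = restrict \<xi> {0..<n}" if eq: "fun_upd \<omega> n x = restrict \<xi> {0..<Suc n}" for x
        proof
          fix k show "\<omega> k = restrict \<xi> {0..<n} k"
            using fun_cong[OF eq, of k] \<omega>
            by (cases "k < n") (auto simp: space_PiM PiE_iff extensional_def)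
        qed
        with False show ?thesis by auto
      qed
      then show ?thesis
        using False unfolding emeasure_eP[OF \<omega> sing] by simp
    qed
    have "emeasure (C 0 (Suc n) ?u) {restrict \<xi> {0..<Suc n}} =
      (\<integral>\<^sup>+\<omega>. emeasure (eP n \<omega>) {restrict \<xi> {0..<Suc n}} \<partial>C 0 n ?u)"
      using u sing[of "Suc n"] measurable_eP[of n]
      by (simp add: emeasure_bind[where N = "PiM {0..<Suc n} ?M"] space_C[OF u]
          measurable_cong_sets[OF sets_C[OF u] refl])
    also have "\<dots> = (\<integral>\<^sup>+\<omega>. ennreal (pmf (step_pmf \<pi> \<epsilon> (map \<xi> [0..<n])) (\<xi> n)) *
        indicator {restrict \<xi> {0..<n}} \<omega> \<partial>C 0 n ?u)"
      by (rule nn_integral_cong) (simp add: eP space_C[OF u])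
    also have "\<dots> = ennreal (pmf (step_pmf \<pi> \<epsilon> (map \<xi> [0..<n])) (\<xi> n)) *
        emeasure (C 0 n ?u) {restrict \<xi> {0..<n}}"
      using sing[of n] by (intro nn_integral_cmult_indicator) (simp add: sets_C[OF u])
    finally show ?case
      by (simp only: Suc.IH prod.lessThan_Suc mult.commute)
  qed
  have "{\<omega>. \<forall>t<n. \<omega> t = \<xi> t} = PF.emb UNIV {0..<n} {restrict \<xi> {0..<n}}"
    by (simp add: prod_emb_def fun_eq_iff restrict_def space_PiM vimage_def)
  then have "emeasure (coupling \<pi> \<epsilon>) {\<omega>. \<forall>t<n. \<omega> t = \<xi> t} = emeasure (CI {0..<n}) {restrict \<xi> {0..<n}}"
    using lim[OF _ sing] by (simp add: coupling_def)
  also have "\<dots> = emeasure (C 0 n (\<lambda>_. undefined)) {restrict \<xi> {0..<n}}"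
    using sing[of n] by (subst emeasure_CI[of _ n]) (auto simp: prod_emb_id)
  finally show ?thesis
    by (simp add: C)
qed

definition success_prob :: "('s::finite, 'a::finite) policy \<Rightarrow> ('s, 'a) teleo_environment \<Rightarrow> real"
  where "success_prob \<pi> \<epsilon> = \<P>(\<omega> in coupling \<pi> \<epsilon>. \<exists>t. snd (snd (\<omega> t)))"

lemma success_event_measurable:
  "{\<omega> \<in> space (coupling \<pi> \<epsilon>). \<exists>t. snd (snd (\<omega> t))} \<in> sets (coupling \<pi> \<epsilon>)"
proof -
  have [measurable]: "(\<lambda>\<omega>. snd (snd (\<omega> t))) \<in> measurable (coupling \<pi> \<epsilon>) (count_space UNIV)" for t
    unfolding measurable_cong_sets[OF sets_coupling refl]
    by (rule measurable_compose[OF measurable_component_singleton]) simp_all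
  show ?thesis
    by measurable
qed

definition optimal_within ::
    "('s::finite, 'a::finite) policy set \<Rightarrow> ('s, 'a) teleo_environment \<Rightarrow> ('s, 'a) policy \<Rightarrow> bool"
  where "optimal_within T \<epsilon> \<pi> \<longleftrightarrow> \<pi> \<in> T \<and> (\<forall>\<pi>'\<in>T. success_prob \<pi> \<epsilon> \<ge> success_prob \<pi>' \<epsilon>)"

end

theory Submission
  imports Defs
begin

text \<open>
  Every failing run is the image under \<^const>\<open>unsuccessful\<close> of a sequence \<open>h\<close> of
  sensor-action pairs, so it is convenient to work with the probability that success never occurs.
  Its one-step recursion (\<open>failure_prob_step\<close>) has one summand for each sensor-action pair, and a
  splice along \<open>h\<close> changes only the summand of the first pair of \<open>h\<close>, in which one finds again a
  splice, along the tail of \<open>h\<close>. Iterating, splicing \<open>\<pi>\<close> with \<open>\<pi>'\<close> along \<open>h\<close> changes the failure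
  probability by exactly the change at the end of \<open>h\<close>, from \<open>\<pi> \<bullet>\<^sub>* h\<close> to \<open>\<pi>' \<bullet>\<^sub>* h\<close>, times the
  probability of the failing run \<open>h\<close> (\<open>failure_prob_splice\<close>).

  That factor is positive, since \<open>h\<close> is possible. Hence a policy \<open>\<tau> \<bullet>\<^sub>* h\<close> that did better than
  \<open>\<pi> \<bullet>\<^sub>* h\<close> after the failing run \<open>h\<close> would make the splice of \<open>\<pi>\<close> with \<open>\<tau>\<close> along \<open>h\<close>, which is in
  the class, better than \<open>\<pi>\<close> itself.
\<close>

section \<open>Probabilities of failing runs\<close>

lemma policy_view_unsuccessful [simp]: "policy_view (unsuccessful z) = z"
  by (cases z) (simp add: policy_view_def unsuccessful_def)

lemma snd_snd_unsuccessful [simp]: "\<not> snd (snd (unsuccessful z))"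
  by (cases z) (simp add: unsuccessful_def)

lemma unsuccessful_policy_view: "\<not> snd (snd x) \<Longrightarrow> unsuccessful (policy_view x) = x"
  by (auto simp: policy_view_def unsuccessful_def split: prod.splits)

primrec failing_run_prob ::
    "('s, 'a) policy \<Rightarrow> ('s, 'a) teleo_environment \<Rightarrow> ('s \<times> 'a) list \<Rightarrow> real" where
  "failing_run_prob \<pi> \<epsilon> [] = 1"
| "failing_run_prob \<pi> \<epsilon> (z # h) = pmf (pair_pmf (out \<pi>) (out \<epsilon>)) (unsuccessful z) *
     failing_run_prob (\<pi> \<bullet>\<^sub>1 z) (\<epsilon> \<bullet>\<^sub>1 unsuccessful z) h"

lemma pmf_pair_unsuccessful:
  "pmf (pair_pmf p q) (unsuccessful z) = pmf p (snd z) * pmf q (snd (unsuccessful z))"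
  by (cases z) (simp add: unsuccessful_def pmf_pair)

lemma failing_run_prob_pos:
  "possible \<pi> h \<Longrightarrow> possible \<epsilon> (map unsuccessful h) \<Longrightarrow> failing_run_prob \<pi> \<epsilon> h > 0"
  by (induction h arbitrary: \<pi> \<epsilon>) (simp_all add: pmf_pair_unsuccessful)

lemma prod_step_pmf_unsuccessful:
  "(\<Prod>t<length h. pmf (step_pmf \<pi> \<epsilon> (map (\<lambda>i. unsuccessful (h ! i)) [0..<t])) (unsuccessful (h ! t)))
    = failing_run_prob \<pi> \<epsilon> h"
proof (induction h arbitrary: \<pi> \<epsilon>)
  case (Cons z h)
  have "step_pmf \<pi> \<epsilon> (map (\<lambda>i. unsuccessful ((z # h) ! i)) [0..<Suc t]) =
      step_pmf (\<pi> \<bullet>\<^sub>1 z) (\<epsilon> \<bullet>\<^sub>1 unsuccessful z) (map (\<lambda>i. unsuccessful (h ! i)) [0..<t])" for t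
  proof -
    have "map (\<lambda>i. unsuccessful ((z # h) ! i)) [0..<Suc t] =
        unsuccessful z # map (\<lambda>i. unsuccessful (h ! i)) [0..<t]"
      by (subst upt_conv_Cons) (simp_all add: map_Suc_upt[symmetric] del: upt_Suc)
    then show ?thesis
      by (simp add: step_pmf_def del: upt_Suc)
  qed
  then show ?case
    using Cons.IH[of "\<pi> \<bullet>\<^sub>1 z" "\<epsilon> \<bullet>\<^sub>1 unsuccessful z"]
    by (simp add: prod.lessThan_Suc_shift step_pmf_def del: upt_Suc prod.lessThan_Suc)
qed simp

lemma prob_space_coupling: "prob_space (coupling \<pi> \<epsilon>)"
  using emeasure_coupling_cylinder[of \<pi> \<epsilon> 0] by (auto intro!: prob_spaceI)

lemma cylinder_measurable:
  "{\<omega>. \<forall>t<n. P t (\<omega> t)} \<in> sets (coupling \<pi> \<epsilon>)"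
proof -
  have [measurable]: "(\<lambda>\<omega>. P t (\<omega> t)) \<in> measurable (coupling \<pi> \<epsilon>) (count_space UNIV)" for t
    unfolding measurable_cong_sets[OF sets_coupling refl]
    by (rule measurable_compose[OF measurable_component_singleton]) simp_all
  have "{\<omega> \<in> space (coupling \<pi> \<epsilon>). \<forall>t<n. P t (\<omega> t)} \<in> sets (coupling \<pi> \<epsilon>)"
    by measurable
  then show ?thesis
    by simp
qed

lemma measure_failing_run:
  "measure (coupling \<pi> \<epsilon>) {\<omega>. \<forall>t<length h. \<omega> t = unsuccessful (h ! t)} = failing_run_prob \<pi> \<epsilon> h"
  unfolding measure_def emeasure_coupling_cylinder
  by (simp add: prod_ennreal prod_nonneg prod_step_pmf_unsuccessful[symmetric])

section \<open>The probability that success never occurs\<close>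

definition failure_prob ::
    "('s::finite, 'a::finite) policy \<Rightarrow> ('s, 'a) teleo_environment \<Rightarrow> real" where
  "failure_prob \<pi> \<epsilon> = measure (coupling \<pi> \<epsilon>) {\<omega>. \<forall>t. \<not> snd (snd (\<omega> t))}"

lemma success_prob_eq: "success_prob \<pi> \<epsilon> = 1 - failure_prob \<pi> \<epsilon>"
proof -
  interpret prob_space "coupling \<pi> \<epsilon>"
    by (rule prob_space_coupling)
  have "{\<omega>. \<forall>t. \<not> snd (snd (\<omega> t))} =
      space (coupling \<pi> \<epsilon>) - {\<omega> \<in> space (coupling \<pi> \<epsilon>). \<exists>t. snd (snd (\<omega> t))}"
    by auto
  then show ?thesis
    unfolding success_prob_def failure_prob_def
    using prob_compl[OF success_event_measurable[of \<pi> \<epsilon>]] by simp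
qed

lemma finite_lists_length: "finite {h :: 'b::finite list. length h = n}"
  using finite_lists_length_eq[of "UNIV :: 'b set" n] by simp

lemma measure_failing_upto:
  fixes \<pi> :: "('s::finite, 'a::finite) policy"
  shows "measure (coupling \<pi> \<epsilon>) {\<omega>. \<forall>t<n. \<not> snd (snd (\<omega> t))} =
    (\<Sum>h | length h = n. failing_run_prob \<pi> \<epsilon> h)"
proof -
  interpret prob_space "coupling \<pi> \<epsilon>"
    by (rule prob_space_coupling)
  define run where
    "run h = {\<omega> :: nat \<Rightarrow> ('s, 'a) step. \<forall>t<n. \<omega> t = unsuccessful (h ! t)}" for h
  have run_prefix: "map (policy_view \<circ> \<omega>) [0..<n] = h" if "length h = n" "\<omega> \<in> run h" for \<omega> h
    using that by (intro nth_equalityI) (auto simp: run_def)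
  have "{\<omega>. \<forall>t<n. \<not> snd (snd (\<omega> t))} = (\<Union>h\<in>{h. length h = n}. run h)"
  proof (intro equalityI subsetI)
    fix \<omega> :: "nat \<Rightarrow> ('s, 'a) step" assume "\<omega> \<in> {\<omega>. \<forall>t<n. \<not> snd (snd (\<omega> t))}"
    then have "\<omega> \<in> run (map (policy_view \<circ> \<omega>) [0..<n])"
      by (simp add: run_def unsuccessful_policy_view)
    then show "\<omega> \<in> (\<Union>h\<in>{h. length h = n}. run h)"
      by (intro UN_I[of "map (policy_view \<circ> \<omega>) [0..<n]"]) simp_all
  qed (auto simp: run_def)
  moreover have "disjoint_family_on run {h. length h = n}"
    unfolding disjoint_family_on_def using run_prefix by blast
  moreover have "run ` {h. length h = n} \<subseteq> sets (coupling \<pi> \<epsilon>)"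
    unfolding run_def by (auto intro: cylinder_measurable)
  ultimately have "prob {\<omega>. \<forall>t<n. \<not> snd (snd (\<omega> t))} = (\<Sum>h | length h = n. prob (run h))"
    using finite_measure_finite_Union[OF finite_lists_length[of n], of run] by simp
  also have "\<dots> = (\<Sum>h | length h = n. failing_run_prob \<pi> \<epsilon> h)"
    by (rule sum.cong) (auto simp: run_def measure_failing_run)
  finally show ?thesis .
qed

lemma failure_prob_LIMSEQ:
  fixes \<pi> :: "('s::finite, 'a::finite) policy"
  shows "(\<lambda>n. \<Sum>h | length h = n. failing_run_prob \<pi> \<epsilon> h) \<longlonglongrightarrow> failure_prob \<pi> \<epsilon>"
proof -
  interpret prob_space "coupling \<pi> \<epsilon>"
    by (rule prob_space_coupling)
  have "(\<Inter>n. {\<omega>. \<forall>t<n. \<not> snd (snd (\<omega> t))}) = {\<omega> :: nat \<Rightarrow> ('s, 'a) step. \<forall>t. \<not> snd (snd (\<omega> t))}"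
    by auto
  moreover have "(\<lambda>n. prob {\<omega>. \<forall>t<n. \<not> snd (snd (\<omega> t))}) \<longlonglongrightarrow>
      prob (\<Inter>n. {\<omega>. \<forall>t<n. \<not> snd (snd (\<omega> t))})"
    by (rule finite_Lim_measure_decseq) (auto simp: decseq_def intro: cylinder_measurable)
  ultimately show ?thesis
    by (simp add: failure_prob_def measure_failing_upto)
qed

lemma sum_lists_length_Suc:
  fixes f :: "'b::finite list \<Rightarrow> real"
  shows "(\<Sum>h | length h = Suc n. f h) = (\<Sum>z\<in>UNIV. \<Sum>h | length h = n. f (z # h))"
proof -
  have "{h :: 'b list. length h = Suc n} = (\<lambda>(z, h). z # h) ` (UNIV \<times> {h. length h = n})"
    by (auto simp: length_Suc_conv image_iff)
  moreover have "inj_on (\<lambda>(z, h). z # h) (UNIV \<times> {h :: 'b list. length h = n})"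
    by (auto simp: inj_on_def)
  ultimately show ?thesis
    by (simp add: sum.reindex sum.cartesian_product case_prod_unfold)
qed

text \<open>
  For a fixed horizon the recursion comes from splitting each run at its first step; it passes to
  the limit because there are only finitely many possible first steps.
\<close>

lemma failure_prob_step:
  "failure_prob \<pi> \<epsilon> = (\<Sum>z\<in>UNIV. pmf (pair_pmf (out \<pi>) (out \<epsilon>)) (unsuccessful z) *
     failure_prob (\<pi> \<bullet>\<^sub>1 z) (\<epsilon> \<bullet>\<^sub>1 unsuccessful z))"
proof (rule LIMSEQ_unique)
  show "(\<lambda>n. \<Sum>h | length h = Suc n. failing_run_prob \<pi> \<epsilon> h) \<longlonglongrightarrow> failure_prob \<pi> \<epsilon>"
    using failure_prob_LIMSEQ by (rule LIMSEQ_Suc)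
  show "(\<lambda>n. \<Sum>h | length h = Suc n. failing_run_prob \<pi> \<epsilon> h) \<longlonglongrightarrow>
      (\<Sum>z\<in>UNIV. pmf (pair_pmf (out \<pi>) (out \<epsilon>)) (unsuccessful z) *
        failure_prob (\<pi> \<bullet>\<^sub>1 z) (\<epsilon> \<bullet>\<^sub>1 unsuccessful z))"
    unfolding sum_lists_length_Suc failing_run_prob.simps sum_distrib_left[symmetric]
    by (intro tendsto_sum tendsto_mult_left failure_prob_LIMSEQ)
qed

section \<open>The effect of splicing\<close>

text \<open>
  Up to the end of \<open>h\<close> both policies behave alike, and a run that leaves \<open>h\<close>, or succeeds on the
  way, contributes equally to both failure probabilities. What remains is the failing run \<open>h\<close>.
\<close>

lemma failure_prob_splice:
  assumes "possible \<pi> h"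
  shows "failure_prob (splice_along \<pi> \<pi>' h) \<epsilon> - failure_prob \<pi> \<epsilon> = failing_run_prob \<pi> \<epsilon> h *
    (failure_prob (\<pi>' \<bullet>\<^sub>* h) (\<epsilon> \<bullet>\<^sub>* map unsuccessful h) -
     failure_prob (\<pi> \<bullet>\<^sub>* h) (\<epsilon> \<bullet>\<^sub>* map unsuccessful h))"
  using assms
proof (induction h arbitrary: \<pi> \<pi>' \<epsilon>)
  case (Cons y h)
  let ?p = "\<lambda>z. pmf (pair_pmf (out \<pi>) (out \<epsilon>)) (unsuccessful z)"
  let ?\<sigma> = "splice_along \<pi> \<pi>' (y # h)"
  let ?\<delta> = "failure_prob (splice_along (\<pi> \<bullet>\<^sub>1 y) (\<pi>' \<bullet>\<^sub>1 y) h) (\<epsilon> \<bullet>\<^sub>1 unsuccessful y) -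
    failure_prob (\<pi> \<bullet>\<^sub>1 y) (\<epsilon> \<bullet>\<^sub>1 unsuccessful y)"
  have out: "out ?\<sigma> = out \<pi>"
    by simp
  have summand: "?p z * failure_prob (?\<sigma> \<bullet>\<^sub>1 z) (\<epsilon> \<bullet>\<^sub>1 unsuccessful z) -
      ?p z * failure_prob (\<pi> \<bullet>\<^sub>1 z) (\<epsilon> \<bullet>\<^sub>1 unsuccessful z) = (if z = y then ?p y * ?\<delta> else 0)" for z
  proof (cases "pmf (out \<pi>) (snd z) > 0")
    case True
    then show ?thesis
      by (simp add: right_diff_distrib)
  next
    case False
    \<comment> \<open>Here evolution has no effect, so the two evolved policies may differ, but with weight zero.\<close>
    then have "?p z = 0"
      using pmf_nonneg[of "out \<pi>" "snd z"] by (simp add: pmf_pair_unsuccessful)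
    then show ?thesis
      by auto
  qed
  have "failure_prob ?\<sigma> \<epsilon> - failure_prob \<pi> \<epsilon> = ?p y * ?\<delta>"
    unfolding failure_prob_step[of ?\<sigma> \<epsilon>] failure_prob_step[of \<pi> \<epsilon>] out sum_subtractf[symmetric] summand
    by simp
  also have "?\<delta> = failing_run_prob (\<pi> \<bullet>\<^sub>1 y) (\<epsilon> \<bullet>\<^sub>1 unsuccessful y) h *
      (failure_prob (\<pi>' \<bullet>\<^sub>* (y # h)) (\<epsilon> \<bullet>\<^sub>* map unsuccessful (y # h)) -
       failure_prob (\<pi> \<bullet>\<^sub>* (y # h)) (\<epsilon> \<bullet>\<^sub>* map unsuccessful (y # h)))"
    using Cons.IH[of "\<pi> \<bullet>\<^sub>1 y" "\<pi>' \<bullet>\<^sub>1 y" "\<epsilon> \<bullet>\<^sub>1 unsuccessful y"] Cons.prems by simp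
  finally show ?case
    by (simp only: failing_run_prob.simps mult.assoc)
qed simp

theorem mainTheorem3:
  fixes T :: "('s::finite, 'a::finite) policy set"
    and \<epsilon> :: "('s, 'a) teleo_environment"
    and \<pi> :: "('s, 'a) policy"
    and h :: "('s \<times> 'a) list"
  assumes "closed_under_splicing T"
    and "optimal_within T \<epsilon> \<pi>"
    and "possible \<pi> h"
    and "possible \<epsilon> (map unsuccessful h)"
  shows "optimal_within {\<tau> \<bullet>\<^sub>* h | \<tau>. \<tau> \<in> T \<and> possible \<tau> h}
    (\<epsilon> \<bullet>\<^sub>* map unsuccessful h) (\<pi> \<bullet>\<^sub>* h)"
proof -
  have "\<pi> \<in> T"
    using assms(2) by (simp add: optimal_within_def)
  have "success_prob (\<tau> \<bullet>\<^sub>* h) (\<epsilon> \<bullet>\<^sub>* map unsuccessful h) \<le>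
      success_prob (\<pi> \<bullet>\<^sub>* h) (\<epsilon> \<bullet>\<^sub>* map unsuccessful h)" if "\<tau> \<in> T" "possible \<tau> h" for \<tau>
  proof -
    have "splice_along \<pi> \<tau> h \<in> T"
      using assms(1,3) \<open>\<pi> \<in> T\<close> that by (simp add: closed_under_splicing_def)
    then have "0 \<le> failure_prob (splice_along \<pi> \<tau> h) \<epsilon> - failure_prob \<pi> \<epsilon>"
      using assms(2) by (simp add: optimal_within_def success_prob_eq)
    then have "0 \<le> failure_prob (\<tau> \<bullet>\<^sub>* h) (\<epsilon> \<bullet>\<^sub>* map unsuccessful h) -
        failure_prob (\<pi> \<bullet>\<^sub>* h) (\<epsilon> \<bullet>\<^sub>* map unsuccessful h)"
      using failing_run_prob_pos[OF assms(3,4)] failure_prob_splice[OF assms(3), of \<tau> \<epsilon>]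
      by (simp add: zero_le_mult_iff)
    then show ?thesis
      by (simp add: success_prob_eq)
  qed
  then show ?thesis
    using \<open>\<pi> \<in> T\<close> assms(3) unfolding optimal_within_def by blast
qed

end
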